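(* Let $G$ be a finitely generated group. Let $\pi$ be an orthogonal representation of $G$ on a separable real Hilbert space $\mathcal{H}$ that weakly contains the irreducible orthogonal representation $\pi'$ of $G$ on a separable real Hilbert space $\mathcal{H}'$. Then for every $v' \in \mathcal{H}'$ there are $\varphi \in b\mathcal{H}$ and $v \in \mathcal{H}$ such that for all $g \in G$, $$[g\varphi](v) = \langle \pi'_g v', v'\rangle + \mathbb{Z}.$$
   Context: $\mathbb{T} = \mathbb{R}/\mathbb{Z}$, and $b\mathcal{H}$ is the group of all (not necessarily continuous) additive maps $\varphi \colon \mathcal{H} \to \mathbb{T}$, on which $G$ acts by $[g\varphi](v) = \varphi(\pi_g^{-1}v)$. Weak containment has its usual meaning: $\pi$ weakly contains $\pi'$ if for every $v' \in \mathcal{H}'$, the function $g \mapsto \langle \pi'_g v', v'\rangle$ on $G$ is a pointwise limit of finite sums of functions of the form $g \mapsto \langle \pi_g v, v\rangle$ with $v \in \mathcal{H}$. A representation is irreducible if it is nonzero and has no closed invariant subspaces other than $0$ and the whole space. *)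

theory Defs
  imports "HOL-Analysis.Analysis" "HOL-Algebra.Generated_Groups"
begin

text \<open>The circle group \<open>\<real>/\<int>\<close>; \<open>modZ x\<close> is the coset \<open>x + \<int>\<close>.\<close>

quotient_type circle = real / "\<lambda>x y. x - y \<in> \<int>"
  morphisms rep_circle modZ
proof (rule equivpI)
  show "reflp (\<lambda>x y::real. x - y \<in> \<int>)"
    by (simp add: reflp_def)
  show "symp (\<lambda>x y::real. x - y \<in> \<int>)"
    by (metis (no_types, lifting) Ints_minus minus_diff_eq sympI)
  show "transp (\<lambda>x y::real. x - y \<in> \<int>)"
  proof (rule transpI)
    fix x y z :: real
    assume "x - y \<in> \<int>" "y - z \<in> \<int>"
    then have "(x - y) + (y - z) \<in> \<int>" by (rule Ints_add)
    then show "x - z \<in> \<int>" by simp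
  qed
qed

instantiation circle :: ab_group_add
begin

lift_definition zero_circle :: circle is "0 :: real" .

lift_definition plus_circle :: "circle \<Rightarrow> circle \<Rightarrow> circle" is "(+) :: real \<Rightarrow> real \<Rightarrow> real"
  by (metis Ints_add add_diff_add)

lift_definition uminus_circle :: "circle \<Rightarrow> circle" is "uminus :: real \<Rightarrow> real"
  by (metis Ints_minus minus_diff_minus)

lift_definition minus_circle :: "circle \<Rightarrow> circle \<Rightarrow> circle" is "(-) :: real \<Rightarrow> real \<Rightarrow> real"
  by (metis Ints_diff diff_diff_eq2 diff_add_eq diff_diff_add add.commute)

instance
  by standard (transfer, simp add: algebra_simps)+

end

definition finitely_generated_group :: "('g, 'm) monoid_scheme \<Rightarrow> bool" where
  "finitely_generated_group G \<longleftrightarrow>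
     group G \<and> (\<exists>S. finite S \<and> S \<subseteq> carrier G \<and> generate G S = carrier G)"

text \<open>In infinite dimension \<^const>\<open>orthogonal_transformation\<close> does not entail surjectivity.\<close>

definition orthogonal_group :: "('h::real_inner \<Rightarrow> 'h) monoid" where
  "orthogonal_group =
     \<lparr>carrier = {f. orthogonal_transformation f \<and> surj f}, mult = (\<circ>), one = id\<rparr>"

definition orthogonal_representation ::
  "('g, 'm) monoid_scheme \<Rightarrow> ('g \<Rightarrow> 'h::real_inner \<Rightarrow> 'h) \<Rightarrow> bool" where
  "orthogonal_representation G \<pi> \<longleftrightarrow> \<pi> \<in> hom G orthogonal_group"

definition invariant_subspace ::
  "('g, 'm) monoid_scheme \<Rightarrow> ('g \<Rightarrow> 'h::real_inner \<Rightarrow> 'h) \<Rightarrow> 'h set \<Rightarrow> bool" where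
  "invariant_subspace G \<pi> W \<longleftrightarrow> subspace W \<and> (\<forall>g\<in>carrier G. \<pi> g ` W \<subseteq> W)"

definition irreducible_representation ::
  "('g, 'm) monoid_scheme \<Rightarrow> ('g \<Rightarrow> 'h::real_inner \<Rightarrow> 'h) \<Rightarrow> bool" where
  "irreducible_representation G \<pi> \<longleftrightarrow>
     (UNIV :: 'h set) \<noteq> {0} \<and>
     (\<forall>W. closed W \<and> invariant_subspace G \<pi> W \<longrightarrow> W = {0} \<or> W = UNIV)"

definition diagonal_coefficient_sums :: "('g \<Rightarrow> 'h::real_inner \<Rightarrow> 'h) \<Rightarrow> ('g \<Rightarrow> real) set" where
  "diagonal_coefficient_sums \<pi> = {\<lambda>g. \<Sum>v\<leftarrow>vs. \<pi> g v \<bullet> v | vs. True}"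

text \<open>
  Pointwise limits are taken along arbitrary proper filters (equivalently, along nets), which
  is the right notion for groups of any cardinality; for countable \<open>G\<close> sequences suffice.
\<close>

definition weakly_contains ::
  "('g, 'm) monoid_scheme \<Rightarrow> ('g \<Rightarrow> 'h::real_inner \<Rightarrow> 'h) \<Rightarrow> ('g \<Rightarrow> 'k::real_inner \<Rightarrow> 'k) \<Rightarrow> bool"
  where
  "weakly_contains G \<pi> \<pi>' \<longleftrightarrow>
     (\<forall>v'. \<exists>F. F \<noteq> bot \<and> (\<forall>\<^sub>F f in F. f \<in> diagonal_coefficient_sums \<pi>) \<and>
        (\<forall>g\<in>carrier G. ((\<lambda>f. f g) \<longlongrightarrow> \<pi>' g v' \<bullet> v') F))"

definition additive_dual :: "('h::ab_group_add \<Rightarrow> circle) set" where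
  "additive_dual = {\<phi>. Modules.additive \<phi>}"

definition dual_action :: "('g \<Rightarrow> 'h \<Rightarrow> 'h) \<Rightarrow> 'g \<Rightarrow> ('h \<Rightarrow> circle) \<Rightarrow> 'h \<Rightarrow> circle" where
  "dual_action \<pi> g \<phi> = (\<lambda>v. \<phi> (inv_into UNIV (\<pi> g) v))"

end

theory Submission
  imports Defs
begin

text \<open>
  The group ring \<open>\<rat>[G]\<close> is countable. By weak containment, whenever \<open>a \<in> \<rat>[G]\<close> does not
  annihilate \<open>v'\<close>, the kernel of \<open>\<pi>(a)\<close> is a proper closed subspace of \<open>\<H>\<close>; by Baire's theorem
  some \<open>v\<close> lies in none of these countably many kernels. Thus the annihilator of \<open>v\<close> in \<open>\<rat>[G]\<close>
  is contained in that of \<open>v'\<close>, so there is a \<open>\<rat>\<close>-linear map \<open>T\<close> with \<open>T (\<pi>\<^sub>g v) = \<pi>'\<^sub>g v'\<close>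
  for all \<open>g\<close>, and \<open>\<phi>(w) = \<langle>T w, v'\<rangle> + \<int>\<close> is as required.
\<close>

section \<open>Countability of generated subgroups and Baire category\<close>

text \<open>Every element of the generated subgroup is the value of a finite word in elements of
  \<open>S\<close> and their inverses, and a countable alphabet has only countably many
  words.\<close>

lemma (in group) countable_generate:
  assumes "countable S" "S \<subseteq> carrier G"
  shows "countable (generate G S)"
proof -
  let ?A = "S \<union> m_inv G ` S"
  have A: "?A \<subseteq> carrier G"
    using assms(2) by auto
  have closed: "foldr (\<otimes>) ws z \<in> carrier G" if "ws \<in> lists ?A" "z \<in> carrier G" for ws z
    using that A by (induction ws) auto
  \<comment> \<open>Pulling an arbitrary tail \<open>z\<close> out as a right factor shows that
    concatenating words multiplies their values.\<close>
  have app: "foldr (\<otimes>) ws z = foldr (\<otimes>) ws \<one> \<otimes> z" if "ws \<in> lists ?A" "z \<in> carrier G" for ws z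
    using that(1)
  proof (induction ws)
    case (Cons a ws)
    then have "a \<in> carrier G" "foldr (\<otimes>) ws \<one> \<in> carrier G"
      using A closed by auto
    with Cons that(2) show ?case
      by (simp add: m_assoc)
  qed (use that in simp)
  have "g \<in> (\<lambda>ws. foldr (\<otimes>) ws \<one>) ` lists ?A" if "g \<in> generate G S" for g
    using that
  proof induction
    case one
    show ?case by (rule image_eqI[of _ _ "[]"]) auto
  next
    case (incl h)
    then show ?case using assms(2) by (intro image_eqI[of _ _ "[h]"]) auto
  next
    case (inv h)
    then show ?case using assms(2) by (intro image_eqI[of _ _ "[inv h]"]) auto
  next
    case (eng h1 h2)
    then obtain us ws where uw: "us \<in> lists ?A" "ws \<in> lists ?A"
      and h: "h1 = foldr (\<otimes>) us \<one>" "h2 = foldr (\<otimes>) ws \<one>"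
      by auto
    have "h1 \<otimes> h2 = foldr (\<otimes>) (us @ ws) \<one>"
      using app[OF uw(1) closed[OF uw(2) one_closed]] by (simp add: h)
    then show ?case
      using uw by (intro image_eqI[of _ _ "us @ ws"]) auto
  qed
  moreover have "countable ((\<lambda>ws. foldr (\<otimes>) ws \<one>) ` lists ?A)"
    using assms(1) by auto
  ultimately show ?thesis
    by (meson countable_subset subsetI)
qed

text \<open>If \<open>W\<close> contains a ball around \<open>x\<close>, it contains
  \<open>x + c *\<^sub>R y\<close> for any \<open>y\<close> and small \<open>c > 0\<close>;
  subtracting \<open>x\<close> and rescaling recovers \<open>y\<close>.\<close>

lemma subspace_interior_nonempty_imp_UNIV:
  fixes W :: "'a::real_normed_vector set"
  assumes "subspace W" "interior W \<noteq> {}"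
  shows "W = UNIV"
proof -
  obtain x e where e: "e > 0" "ball x e \<subseteq> W"
    using assms(2) by (auto simp: mem_interior)
  have "y \<in> W" for y
  proof -
    \<comment> \<open>Small enough that \<open>c * norm y < e\<close>; the \<open>+ 1\<close> keeps
      the denominator positive when \<open>y = 0\<close>.\<close>
    define c where "c = e / (2 * (norm y + 1))"
    have c: "c > 0"
      using e by (simp add: c_def add_nonneg_pos)
    have "c * norm y = e * (norm y / (2 * (norm y + 1)))"
      by (simp add: c_def)
    also have "\<dots> < e * 1"
      using e by (intro mult_strict_left_mono) (auto simp: divide_less_eq add_nonneg_pos)
    finally have "x + c *\<^sub>R y \<in> ball x e"
      using c by (simp add: dist_norm)
    then have "x + c *\<^sub>R y \<in> W" "x \<in> W"
      using e by auto
    then have "(x + c *\<^sub>R y) - x \<in> W"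
      by (intro subspace_diff[OF assms(1)])
    then have "c *\<^sub>R y \<in> W"
      by simp
    then show ?thesis
      using subspace_scale[OF assms(1), of "c *\<^sub>R y" "1 / c"] c by simp
  qed
  then show ?thesis by auto
qed

text \<open>Proper closed subspaces have empty interior, so by Baire's theorem their countable union
  has empty interior too.\<close>

lemma countable_closed_subspaces_not_cover:
  fixes \<W> :: "'a::{real_normed_vector, complete_space} set set"
  assumes "countable \<W>" "\<And>W. W \<in> \<W> \<Longrightarrow> closed W \<and> subspace W \<and> W \<noteq> UNIV"
  shows "\<Union>\<W> \<noteq> UNIV"
proof -
  have "euclidean interior_of \<Union>\<W> = {}"
    using assms subspace_interior_nonempty_imp_UNIV
    by (intro Baire_category_alt) (auto simp: completely_metrizable_space_euclidean)
  then show ?thesis by auto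
qed

section \<open>Linear maps with prescribed values on a family\<close>

text \<open>Every linear relation among the \<open>x i\<close> persists among the
  \<open>y i\<close>. Hence \<open>T\<close> may be prescribed on a basis chosen among the
  \<open>x i\<close>, and \<open>rel\<close> then forces the right value at the remaining
  ones.\<close>

lemma (in vector_space_pair) exists_linear_on_family:
  assumes rel: "\<And>F q. finite F \<Longrightarrow> F \<subseteq> I \<Longrightarrow> (\<Sum>i\<in>F. q i *a x i) = 0 \<Longrightarrow> (\<Sum>i\<in>F. q i *b y i) = 0"
  shows "\<exists>T. Vector_Spaces.linear s1 s2 T \<and> (\<forall>i\<in>I. T (x i) = y i)"
proof -
  obtain B where B: "B \<subseteq> x ` I" "vs1.independent B" "x ` I \<subseteq> vs1.span B"
    using vs1.maximal_independent_subset by blast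
  \<comment> \<open>The family \<open>x\<close> may repeat vectors, so \<open>J\<close> picks
    exactly one index for each basis vector.\<close>
  obtain J where J: "J \<subseteq> I" "inj_on x J" "B = x ` J"
    using B(1) by (auto simp: subset_image_inj)
  obtain T where T: "Vector_Spaces.linear s1 s2 T" "\<forall>b\<in>B. T b = y (the_inv_into J x b)"
    using linear_independent_extend[OF B(2), of "\<lambda>b. y (the_inv_into J x b)"] by blast
  interpret T: Vector_Spaces.linear s1 s2 T by (rule T(1))
  have TJ: "T (x j) = y j" if "j \<in> J" for j
    using T(2) J that by (simp add: the_inv_into_f_f)
  have "T (x i) = y i" if i: "i \<in> I" for i
  proof (cases "i \<in> J")
    case False
    obtain t r where t: "finite t" "t \<subseteq> B" "x i = (\<Sum>a\<in>t. r a *a a)"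
      using B(3) i by (auto simp: vs1.span_explicit)
    obtain K where K: "K \<subseteq> J" "t = x ` K"
      using t(2) J(3) by (auto simp: subset_image_iff)
    have inj: "inj_on x K"
      using J(2) K(1) inj_on_subset by blast
    have fin: "finite K"
      using t(1) K(2) inj finite_image_iff by blast
    have iK: "i \<notin> K"
      using False K(1) by auto
    have xi: "x i = (\<Sum>j\<in>K. r (x j) *a x j)"
      using t(3) K(2) inj by (simp add: sum.reindex)
    \<comment> \<open>The coefficient \<open>- 1\<close> at \<open>i\<close> turns the expansion of
      \<open>x i\<close> into a vanishing relation, to which \<open>rel\<close> applies.\<close>
    let ?q = "\<lambda>j. if j = i then - 1 else r (x j)"
    have eqs: "(\<Sum>j\<in>K. ?q j *a x j) = (\<Sum>j\<in>K. r (x j) *a x j)"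
              "(\<Sum>j\<in>K. ?q j *b y j) = (\<Sum>j\<in>K. r (x j) *b y j)"
      using iK by (auto intro!: sum.cong)
    have "(\<Sum>j\<in>insert i K. ?q j *b y j) = 0"
    proof (rule rel)
      show "(\<Sum>j\<in>insert i K. ?q j *a x j) = 0"
        using fin iK eqs(1) xi by simp
    qed (use fin K J i in auto)
    then have "y i = (\<Sum>j\<in>K. r (x j) *b y j)"
      using fin iK eqs(2) by simp
    also have "\<dots> = (\<Sum>j\<in>K. r (x j) *b T (x j))"
      using TJ K(1) by (intro sum.cong) auto
    also have "\<dots> = T (x i)"
      by (simp add: xi T.sum T.scale)
    finally show ?thesis ..
  qed (rule TJ)
  with T(1) show ?thesis by blast
qed

section \<open>Basic properties of orthogonal representations\<close>

lemma orthogonal_representationD: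
  assumes "orthogonal_representation G \<pi>" "g \<in> carrier G"
  shows "orthogonal_transformation (\<pi> g)" "surj (\<pi> g)"
  using assms by (auto simp: orthogonal_representation_def orthogonal_group_def hom_def)

lemma orthogonal_representation_mult:
  assumes "orthogonal_representation G \<pi>" "g \<in> carrier G" "h \<in> carrier G"
  shows "\<pi> (g \<otimes>\<^bsub>G\<^esub> h) w = \<pi> g (\<pi> h w)"
  using assms by (auto simp: orthogonal_representation_def orthogonal_group_def hom_def)

lemma orthogonal_representation_one:
  assumes "group G" "orthogonal_representation G \<pi>"
  shows "\<pi> \<one>\<^bsub>G\<^esub> w = w"
proof -
  interpret group G by fact
  obtain u where "w = \<pi> \<one>\<^bsub>G\<^esub> u"
    using orthogonal_representationD(2)[OF assms(2) one_closed] by blast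
  then show ?thesis
    using orthogonal_representation_mult[OF assms(2) one_closed one_closed, of u] by simp
qed

text \<open>Writing \<open>g\<close> as \<open>h\<close> times the inverse of \<open>h\<close> times
  \<open>g\<close>, the isometry \<open>\<pi> h\<close> cancels from both sides. For
  \<open>u = w\<close> this leaves a diagonal coefficient.\<close>

lemma inner_orthogonal_representation:
  assumes "group G" "orthogonal_representation G \<pi>" "g \<in> carrier G" "h \<in> carrier G"
  shows "\<pi> g u \<bullet> \<pi> h w = \<pi> (inv\<^bsub>G\<^esub> h \<otimes>\<^bsub>G\<^esub> g) u \<bullet> w"
proof -
  interpret group G by fact
  have "h \<otimes>\<^bsub>G\<^esub> (inv\<^bsub>G\<^esub> h \<otimes>\<^bsub>G\<^esub> g) = g"
    using assms(3,4) by (simp flip: m_assoc)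
  then have "\<pi> g u = \<pi> h (\<pi> (inv\<^bsub>G\<^esub> h \<otimes>\<^bsub>G\<^esub> g) u)"
    using orthogonal_representation_mult[OF assms(2,4), of "inv\<^bsub>G\<^esub> h \<otimes>\<^bsub>G\<^esub> g" u] assms(3,4) by simp
  then show ?thesis
    using orthogonal_representationD(1)[OF assms(2,4)] by (simp add: orthogonal_transformation_def)
qed

lemma inv_into_orthogonal_representation:
  assumes "group G" "orthogonal_representation G \<pi>" "g \<in> carrier G"
  shows "inv_into UNIV (\<pi> g) w = \<pi> (inv\<^bsub>G\<^esub> g) w"
proof (rule inv_f_eq)
  interpret group G by fact
  show "inj (\<pi> g)"
    using orthogonal_representationD(1)[OF assms(2,3)] by (rule orthogonal_transformation_inj)
  show "\<pi> g (\<pi> (inv\<^bsub>G\<^esub> g) w) = w"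
    using orthogonal_representation_mult[OF assms(2,3), of "inv\<^bsub>G\<^esub> g" w]
      orthogonal_representation_one[OF assms(1,2)] assms(3) by simp
qed

section \<open>The group ring action and weak containment\<close>

text \<open>The action of the group ring element with coefficients \<open>q\<close> on a finite
  support \<open>F\<close>; values of \<open>q\<close> outside \<open>F\<close> are
  irrelevant.\<close>

definition group_ring_action :: "('g \<Rightarrow> 'h::real_vector \<Rightarrow> 'h) \<Rightarrow> 'g set \<Rightarrow> ('g \<Rightarrow> real) \<Rightarrow> 'h \<Rightarrow> 'h"
  where "group_ring_action \<pi> F q w = (\<Sum>g\<in>F. q g *\<^sub>R \<pi> g w)"

text \<open>The squared norm depends only on the diagonal coefficient of \<open>w\<close>, which is
  the data that weak containment controls.\<close>

lemma inner_group_ring_action: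
  assumes "group G" "orthogonal_representation G \<pi>" "F \<subseteq> carrier G"
  shows "group_ring_action \<pi> F q w \<bullet> group_ring_action \<pi> F q w =
    (\<Sum>g\<in>F. \<Sum>h\<in>F. q g * q h * (\<pi> (inv\<^bsub>G\<^esub> h \<otimes>\<^bsub>G\<^esub> g) w \<bullet> w))"
proof -
  have "group_ring_action \<pi> F q w \<bullet> group_ring_action \<pi> F q w =
      (\<Sum>g\<in>F. \<Sum>h\<in>F. q g * q h * (\<pi> g w \<bullet> \<pi> h w))"
    by (simp add: group_ring_action_def inner_sum_left inner_sum_right sum_distrib_left
        inner_commute mult_ac)
  also have "\<dots> = (\<Sum>g\<in>F. \<Sum>h\<in>F. q g * q h * (\<pi> (inv\<^bsub>G\<^esub> h \<otimes>\<^bsub>G\<^esub> g) w \<bullet> w))"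
    using assms(3) by (intro sum.cong refl) (simp add: inner_orthogonal_representation[OF assms(1,2)] subset_iff)
  finally show ?thesis .
qed

lemma group_ring_action_closed_subspace:
  assumes "orthogonal_representation G \<pi>" "F \<subseteq> carrier G"
  shows "closed {w. group_ring_action \<pi> F q w = 0}" "subspace {w. group_ring_action \<pi> F q w = 0}"
proof -
  have lin: "linear (\<pi> g)" if "g \<in> F" for g
    using orthogonal_representationD(1)[OF assms(1)] assms(2) that
    by (auto intro: orthogonal_transformation_linear)
  have bl: "bounded_linear (\<pi> g)" if "g \<in> F" for g
  proof -
    have "norm (\<pi> g w) = norm w" for w
      using orthogonal_representationD(1)[OF assms(1)] assms(2) that
      by (auto simp: orthogonal_transformation_norm)
    then show ?thesis
      using lin[OF that] by (intro bounded_linear_intro[of _ 1]) (auto simp: linear_add linear_scale)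
  qed
  have "bounded_linear (group_ring_action \<pi> F q)"
    unfolding group_ring_action_def
    by (intro bounded_linear_sum bounded_linear_compose[OF bounded_linear_scaleR_right] bl)
  then show "subspace {w. group_ring_action \<pi> F q w = 0}"
    "closed {w. group_ring_action \<pi> F q w = 0}"
    by (auto intro!: closed_Collect_eq linear_continuous_on linear_subspace_kernel
        simp: bounded_linear.linear)
qed

text \<open>The squared norm of the image of \<open>v'\<close> is a limit of finite sums of squared
  norms of images under the action through \<open>\<pi>\<close>, all of which vanish.\<close>

lemma weakly_contains_kernel:
  assumes "group G" "orthogonal_representation G \<pi>" "orthogonal_representation G \<pi>'"
    and "weakly_contains G \<pi> \<pi>'" "F \<subseteq> carrier G"
    and zero: "\<And>w. group_ring_action \<pi> F q w = 0"
  shows "group_ring_action \<pi>' F q v' = 0"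
proof -
  interpret group G by fact
  \<comment> \<open>The squared norm as a functional of the coefficient function: it is linear in
    \<open>f\<close> and respects pointwise limits.\<close>
  let ?S = "\<lambda>f. \<Sum>g\<in>F. \<Sum>h\<in>F. q g * q h * f (inv\<^bsub>G\<^esub> h \<otimes>\<^bsub>G\<^esub> g)"
  obtain A where A: "A \<noteq> bot" "\<forall>\<^sub>F f in A. f \<in> diagonal_coefficient_sums \<pi>"
    "\<And>g. g \<in> carrier G \<Longrightarrow> ((\<lambda>f. f g) \<longlongrightarrow> \<pi>' g v' \<bullet> v') A"
    using assms(4) unfolding weakly_contains_def by (elim allE[of _ v'] exE) blast
  have "(?S \<longlongrightarrow> ?S (\<lambda>g. \<pi>' g v' \<bullet> v')) A"
    using assms(5) by (intro tendsto_sum tendsto_mult_left A(3)) (auto simp: subset_iff)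
  moreover have "?S f = 0" if "f \<in> diagonal_coefficient_sums \<pi>" for f
  proof -
    have "?S (\<lambda>g. \<Sum>v\<leftarrow>vs. \<pi> g v \<bullet> v) = 0" for vs
    proof (induction vs)
      case (Cons v vs)
      have "?S (\<lambda>g. \<pi> g v \<bullet> v) = 0"
        using inner_group_ring_action[OF assms(1,2,5), of q v] zero by simp
      with Cons show ?case
        by (simp add: distrib_left sum.distrib)
    qed simp
    with that show ?thesis
      by (auto simp: diagonal_coefficient_sums_def)
  qed
  then have "(?S \<longlongrightarrow> 0) A"
    using A(2) by (intro tendsto_eventually) (auto elim!: eventually_mono)
  ultimately have "?S (\<lambda>g. \<pi>' g v' \<bullet> v') = 0"
    using A(1) tendsto_unique by blast
  then show ?thesis
    using inner_group_ring_action[OF assms(1,3,5), of q v'] by simp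
qed

lemma exists_vector_with_smaller_annihilator:
  fixes \<pi> :: "'g \<Rightarrow> 'h::{real_inner, complete_space} \<Rightarrow> 'h"
  assumes "group G" "countable (carrier G)"
    and "orthogonal_representation G \<pi>" "orthogonal_representation G \<pi>'" "weakly_contains G \<pi> \<pi>'"
  obtains v where "\<And>F q. finite F \<Longrightarrow> F \<subseteq> carrier G \<Longrightarrow>
    group_ring_action \<pi> F (of_rat \<circ> q) v = 0 \<Longrightarrow> group_ring_action \<pi>' F (of_rat \<circ> q) v' = 0"
proof -
  \<comment> \<open>Functions extensional on a finite \<open>F\<close> with rational values keep the
    index set countable, as Baire's theorem requires.\<close>
  define I where "I = (SIGMA F:{F. finite F \<and> F \<subseteq> carrier G}. F \<rightarrow>\<^sub>E (UNIV :: rat set))"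
  define ker where "ker = (\<lambda>(F, q). {w. group_ring_action \<pi> F (of_rat \<circ> q) w = 0})"
  define I' where "I' = {(F, q) \<in> I. group_ring_action \<pi>' F (of_rat \<circ> q) v' \<noteq> 0}"
  have "countable I"
    unfolding I_def
    by (intro countable_SIGMA countable_Collect_finite_subset assms(2)) (auto intro: countable_PiE)
  then have "countable (ker ` I')"
    by (rule countable_image[OF countable_subset, rotated]) (auto simp: I'_def)
  moreover have "closed W \<and> subspace W \<and> W \<noteq> UNIV" if "W \<in> ker ` I'" for W
  proof -
    from that obtain F q where "(F, q) \<in> I'" "W = ker (F, q)"
      by (elim imageE) (auto simp only: split_paired_all)
    then have F: "F \<subseteq> carrier G" "group_ring_action \<pi>' F (of_rat \<circ> q) v' \<noteq> 0"
      and W: "W = {w. group_ring_action \<pi> F (of_rat \<circ> q) w = 0}"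
      by (auto simp: I_def I'_def ker_def)
    have "W \<noteq> UNIV"
      using weakly_contains_kernel[OF assms(1,3,4,5) F(1)] F(2) unfolding W by blast
    then show ?thesis
      using group_ring_action_closed_subspace[OF assms(3) F(1)] unfolding W by blast
  qed
  ultimately obtain v where v: "v \<notin> \<Union>(ker ` I')"
    using countable_closed_subspaces_not_cover[of "ker ` I'"] by blast
  show ?thesis
  proof (rule that, rule ccontr)
    fix F and q :: "'g \<Rightarrow> rat"
    assume F: "finite F" "F \<subseteq> carrier G" "group_ring_action \<pi> F (of_rat \<circ> q) v = 0"
      "group_ring_action \<pi>' F (of_rat \<circ> q) v' \<noteq> 0"
    \<comment> \<open>Restricting \<open>q\<close> to \<open>F\<close> leaves the action unchanged
      and brings the pair into the countable index set.\<close>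
    have restr: "group_ring_action \<pi> F (of_rat \<circ> restrict q F) v = 0"
      "group_ring_action \<pi>' F (of_rat \<circ> restrict q F) v' \<noteq> 0"
      using F(3,4) by (simp_all add: group_ring_action_def)
    then have "(F, restrict q F) \<in> I'"
      using F(1,2) by (simp add: I_def I'_def)
    with restr(1) v show False
      by (force simp: ker_def)
  qed
qed

section \<open>Construction of the additive map into the circle\<close>

theorem proposition5:
  fixes G :: "('g, 'm) monoid_scheme"
    and \<pi> :: "'g \<Rightarrow> 'h::{real_inner, complete_space} \<Rightarrow> 'h"
    and \<pi>' :: "'g \<Rightarrow> 'k::{real_inner, complete_space} \<Rightarrow> 'k"
  assumes "finitely_generated_group G"
    and "separable_space (euclidean :: 'h topology)"
    and "separable_space (euclidean :: 'k topology)"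
    and "orthogonal_representation G \<pi>"
    and "orthogonal_representation G \<pi>'"
    and "irreducible_representation G \<pi>'"
    and "weakly_contains G \<pi> \<pi>'"
  shows "\<forall>v'. \<exists>\<phi>\<in>additive_dual. \<exists>v. \<forall>g\<in>carrier G.
           dual_action \<pi> g \<phi> v = modZ (\<pi>' g v' \<bullet> v')"
proof
  fix v' :: 'k
  note rep = assms(4) and rep' = assms(5)
  interpret group G
    using assms(1) by (simp add: finitely_generated_group_def)
  have "countable (carrier G)"
    using assms(1) countable_generate
    by (metis finitely_generated_group_def countable_finite)
  then obtain v where v: "\<And>F q. finite F \<Longrightarrow> F \<subseteq> carrier G \<Longrightarrow>
      group_ring_action \<pi> F (of_rat \<circ> q) v = 0 \<Longrightarrow> group_ring_action \<pi>' F (of_rat \<circ> q) v' = 0"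
    using exists_vector_with_smaller_annihilator[OF is_group _ rep rep' assms(7)] by blast
  \<comment> \<open>Both Hilbert spaces are viewed over the rationals, since the annihilators of
    \<open>v\<close> and \<open>v'\<close> are compared only for rational coefficients;
    \<open>T\<close> need be neither real-linear nor continuous.\<close>
  interpret Q: vector_space_pair "\<lambda>(q::rat) (x::'h). of_rat q *\<^sub>R x" "\<lambda>(q::rat) (x::'k). of_rat q *\<^sub>R x"
    by unfold_locales (simp_all add: scaleR_add_right scaleR_add_left of_rat_add of_rat_mult)
  obtain T where T: "Vector_Spaces.linear (\<lambda>(q::rat) (x::'h). of_rat q *\<^sub>R x) (\<lambda>(q::rat) (x::'k). of_rat q *\<^sub>R x) T"
    "\<And>g. g \<in> carrier G \<Longrightarrow> T (\<pi> g v) = \<pi>' g v'"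
    using Q.exists_linear_on_family[of "carrier G" "\<lambda>g. \<pi> g v" "\<lambda>g. \<pi>' g v'",
        OF v[unfolded group_ring_action_def comp_def]] by blast
  interpret T: Vector_Spaces.linear "\<lambda>(q::rat) (x::'h). of_rat q *\<^sub>R x" "\<lambda>(q::rat) (x::'k). of_rat q *\<^sub>R x" T
    by (rule T(1))
  define \<phi> where "\<phi> = (\<lambda>w. modZ (T w \<bullet> v'))"
  have "\<phi> \<in> additive_dual"
    by (simp add: additive_dual_def Modules.additive_def \<phi>_def T.add inner_add_left plus_circle.abs_eq)
  moreover have "dual_action \<pi> g \<phi> v = modZ (\<pi>' g v' \<bullet> v')" if g: "g \<in> carrier G" for g
  proof -
    \<comment> \<open>The dual action evaluates at the inverse of \<open>g\<close>; symmetry of the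
      real inner product turns that coefficient back into the one at \<open>g\<close>.\<close>
    have "\<pi>' g v' \<bullet> v' = \<pi>' \<one>\<^bsub>G\<^esub> v' \<bullet> \<pi>' g v'"
      by (simp add: orthogonal_representation_one[OF is_group rep'] inner_commute)
    also have "\<dots> = \<pi>' (inv\<^bsub>G\<^esub> g) v' \<bullet> v'"
      using g by (simp add: inner_orthogonal_representation[OF is_group rep'])
    finally show ?thesis
      using g by (simp add: dual_action_def \<phi>_def T(2) inv_into_orthogonal_representation[OF is_group rep])
  qed
  ultimately show "\<exists>\<phi>\<in>additive_dual. \<exists>v. \<forall>g\<in>carrier G. dual_action \<pi> g \<phi> v = modZ (\<pi>' g v' \<bullet> v')"
    by blast
qed

end
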